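(* Let $H$ be a commutative ring with identity that satisfies the finite annihilator condition (f.a.c.), let $S\subseteq H$ be a multiplicatively closed subset, and let $A$ be an ideal of $H$. Then $A$ is an $S$-$r$-ideal of the ring $H$ if and only if $A[x]$ is an $S$-$r$-ideal of the polynomial ring $H[x]$.
   Context: For a subset or element $T$ of a ring $R$, $\mathrm{Ann}(T)=\{y\in R: yT=0\}$. $H$ satisfies the finite annihilator condition (f.a.c.) if for each nonempty finite subset $F$ of $H$ there is $w\in F$ such that $\mathrm{Ann}(F)=\mathrm{Ann}(w)$. For an ideal $A$ of $H$, $A[x]$ is the ideal of $H[x]$ consisting of polynomials all of whose coefficients lie in $A$. A multiplicatively closed subset of a ring is a subset containing $1$ and closed under products; $S\subseteq H$ is viewed as a multiplicatively closed subset of $H[x]$ (constant polynomials). An ideal $A$ of a ring $R$ is an $S$-$r$-ideal if $A\cap S=\varnothing$ and there exists $s\in S$ such that for all $w,z\in R$, if $wz\in A$ and $\mathrm{Ann}_R(w)=0$, then $sz\in A$. *)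

theory Defs
  imports "HOL-Algebra.UnivPoly"
begin

definition annihilator :: "('a, 'm) ring_scheme \<Rightarrow> 'a set \<Rightarrow> 'a set" where
  "annihilator R T = {y \<in> carrier R. \<forall>t\<in>T. y \<otimes>\<^bsub>R\<^esub> t = \<zero>\<^bsub>R\<^esub>}"

definition finite_annihilator_condition :: "('a, 'm) ring_scheme \<Rightarrow> bool" where
  "finite_annihilator_condition R \<longleftrightarrow>
     (\<forall>F. F \<subseteq> carrier R \<and> finite F \<and> F \<noteq> {} \<longrightarrow>
        (\<exists>w\<in>F. annihilator R F = annihilator R {w}))"

definition S_r_ideal :: "('a, 'm) ring_scheme \<Rightarrow> 'a set \<Rightarrow> 'a set \<Rightarrow> bool" where
  "S_r_ideal R S A \<longleftrightarrow>
     ideal A R \<and> A \<inter> S = {} \<and>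
     (\<exists>s\<in>S. \<forall>w\<in>carrier R. \<forall>z\<in>carrier R.
        w \<otimes>\<^bsub>R\<^esub> z \<in> A \<and> annihilator R {w} = {\<zero>\<^bsub>R\<^esub>} \<longrightarrow> s \<otimes>\<^bsub>R\<^esub> z \<in> A)"

definition poly_extension :: "('a, 'm) ring_scheme \<Rightarrow> 'a set \<Rightarrow> (nat \<Rightarrow> 'a) set" where
  "poly_extension R A = {p \<in> carrier (UP R). \<forall>n. coeff (UP R) p n \<in> A}"

definition constant_polys :: "('a, 'm) ring_scheme \<Rightarrow> 'a set \<Rightarrow> (nat \<Rightarrow> 'a) set" where
  "constant_polys R S = (\<lambda>s. monom (UP R) s 0) ` S"

end

theory Submission
  imports Defs
begin

text \<open>
  Call an element regular if its annihilator is zero. In both directions the same \<open>s\<close>, viewed as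
  a constant polynomial or not, serves as the witness.

  From \<open>H[x]\<close> to \<open>H\<close> there is only to see that a regular element of \<open>H\<close> remains regular as a
  constant polynomial. From \<open>H\<close> to \<open>H[x]\<close>, let \<open>f g\<close> lie in \<open>A[x]\<close> with \<open>f\<close> regular. An element
  of \<open>H\<close> that kills every coefficient of \<open>f\<close> kills \<open>f\<close>, so the finitely many coefficients have zero
  common annihilator, and the finite annihilator condition makes a single coefficient \<open>a\<close> regular.
  Let \<open>B\<close> be the ideal of all \<open>z\<close> that some regular element multiplies into \<open>A\<close>
  (lemma \<open>ideal_regular_saturation\<close>). Since products of regular elements are regular, \<open>a\<close> is a
  non-zero-divisor modulo \<open>B\<close>. McCoy's theorem for \<open>H/B\<close> says that a zero divisor of \<open>(H/B)[x]\<close>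
  is killed by a nonzero constant, which is impossible for the image of \<open>f\<close>; hence \<open>g\<close> lies in
  \<open>B[x]\<close> (lemma \<open>cancel_modulo_poly_extension\<close>). Finally the \<open>S\<close>-\<open>r\<close>-property of \<open>A\<close>
  says precisely that \<open>s B\<close> is contained in \<open>A\<close>, and so \<open>s g\<close> lies in \<open>A[x]\<close>.
\<close>

section \<open>Saturation of an ideal by the regular elements\<close>

definition regular_saturation :: "('a, 'm) ring_scheme \<Rightarrow> 'a set \<Rightarrow> 'a set" where
  "regular_saturation R A =
     {z \<in> carrier R. \<exists>r\<in>carrier R. annihilator R {r} = {\<zero>\<^bsub>R\<^esub>} \<and> r \<otimes>\<^bsub>R\<^esub> z \<in> A}"

context cring
begin

lemma annihilator_singleton_trivial_iff:
  assumes "r \<in> carrier R"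
  shows "annihilator R {r} = {\<zero>} \<longleftrightarrow> (\<forall>y\<in>carrier R. y \<otimes> r = \<zero> \<longrightarrow> y = \<zero>)"
  using assms by (auto simp: annihilator_def)

lemma regular_mult:
  assumes "r \<in> carrier R" "t \<in> carrier R"
    and "annihilator R {r} = {\<zero>}" "annihilator R {t} = {\<zero>}"
  shows "annihilator R {r \<otimes> t} = {\<zero>}"
proof -
  have "y = \<zero>" if "y \<in> carrier R" "y \<otimes> (r \<otimes> t) = \<zero>" for y
  proof -
    have "y \<otimes> r \<otimes> t = \<zero>" using that assms(1,2) by (simp add: m_assoc)
    then have "y \<otimes> r = \<zero>"
      using that(1) assms by (meson annihilator_singleton_trivial_iff m_closed)
    then show "y = \<zero>"
      using that(1) assms by (meson annihilator_singleton_trivial_iff)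
  qed
  then show ?thesis using assms(1,2) by (simp add: annihilator_singleton_trivial_iff)
qed

lemma regular_saturationI:
  assumes "r \<in> carrier R" "z \<in> carrier R" "annihilator R {r} = {\<zero>}" "r \<otimes> z \<in> A"
  shows "z \<in> regular_saturation R A"
  using assms by (auto simp: regular_saturation_def)

lemma regular_saturationE:
  assumes "z \<in> regular_saturation R A"
  obtains r where "r \<in> carrier R" "z \<in> carrier R" "annihilator R {r} = {\<zero>}" "r \<otimes> z \<in> A"
  using assms by (auto simp: regular_saturation_def)

lemma subset_regular_saturation:
  assumes "ideal A R"
  shows "A \<subseteq> regular_saturation R A"
proof
  fix z assume z: "z \<in> A"
  interpret A: ideal A R by fact
  have "z \<in> carrier R" using z by (rule A.Icarr)
  moreover from this z have "\<one> \<otimes> z \<in> A" by simp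
  moreover have "annihilator R {\<one>} = {\<zero>}"
    by (simp add: annihilator_singleton_trivial_iff)
  ultimately show "z \<in> regular_saturation R A"
    by (intro regular_saturationI[of \<one>]) auto
qed

text \<open>
  Closure under sums needs one regular multiplier for both summands; the product of their two
  multipliers is one.
\<close>
lemma ideal_regular_saturation:
  assumes "ideal A R"
  shows "ideal (regular_saturation R A) R"
proof (rule idealI)
  interpret A: ideal A R by fact
  let ?B = "regular_saturation R A"
  show "ring R" by (rule ring_axioms)
  have absorb: "x \<otimes> z \<in> ?B" if z: "z \<in> ?B" and x: "x \<in> carrier R" for z x
  proof -
    from z obtain r where r: "r \<in> carrier R" "z \<in> carrier R" "annihilator R {r} = {\<zero>}" "r \<otimes> z \<in> A"
      by (rule regular_saturationE)
    have "x \<otimes> (r \<otimes> z) \<in> A" using r x by (simp add: A.I_l_closed)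
    also have "x \<otimes> (r \<otimes> z) = r \<otimes> (x \<otimes> z)" using r x by (simp add: m_lcomm)
    finally show ?thesis using r x by (intro regular_saturationI[of r]) auto
  qed
  show "subgroup ?B (add_monoid R)"
  proof (rule add.subgroupI)
    show "?B \<subseteq> carrier R" by (auto simp: regular_saturation_def)
    show "?B \<noteq> {}" using subset_regular_saturation[OF assms] A.zero_closed by blast
  next
    fix z assume z: "z \<in> ?B"
    then have "z \<in> carrier R" by (rule regular_saturationE)
    then show "\<ominus> z \<in> ?B" using absorb[OF z, of "\<ominus> \<one>"] by (simp add: l_minus)
  next
    fix y z assume "y \<in> ?B" "z \<in> ?B"
    obtain r where r: "r \<in> carrier R" "y \<in> carrier R" "annihilator R {r} = {\<zero>}" "r \<otimes> y \<in> A"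
      using \<open>y \<in> ?B\<close> by (rule regular_saturationE)
    obtain t where t: "t \<in> carrier R" "z \<in> carrier R" "annihilator R {t} = {\<zero>}" "t \<otimes> z \<in> A"
      using \<open>z \<in> ?B\<close> by (rule regular_saturationE)
    have "t \<otimes> (r \<otimes> y) \<oplus> r \<otimes> (t \<otimes> z) \<in> A"
      using r t by (simp add: A.I_l_closed)
    also have "t \<otimes> (r \<otimes> y) \<oplus> r \<otimes> (t \<otimes> z) = (r \<otimes> t) \<otimes> (y \<oplus> z)"
      using r t by algebra
    finally show "y \<oplus> z \<in> ?B"
      using r t regular_mult[of r t] by (intro regular_saturationI[of "r \<otimes> t"]) auto
  qed
  show "x \<otimes> z \<in> ?B" if "z \<in> ?B" "x \<in> carrier R" for z x
    using that by (rule absorb)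
  show "z \<otimes> x \<in> ?B" if "z \<in> ?B" "x \<in> carrier R" for z x
    using absorb[OF that] that by (auto elim: regular_saturationE simp: m_comm)
qed

lemma regular_saturation_cancel:
  assumes "a \<in> carrier R" "z \<in> carrier R" "annihilator R {a} = {\<zero>}"
    and "a \<otimes> z \<in> regular_saturation R A"
  shows "z \<in> regular_saturation R A"
proof -
  from assms(4) obtain r where r: "r \<in> carrier R" "annihilator R {r} = {\<zero>}" "r \<otimes> (a \<otimes> z) \<in> A"
    by (rule regular_saturationE)
  with assms show ?thesis
    using regular_mult[of r a] by (intro regular_saturationI[of "r \<otimes> a"]) (auto simp: m_assoc)
qed

section \<open>Finite sums and ideals\<close>

lemma finsum_in_ideal:
  assumes "ideal I R" "finite K" "\<And>j. j \<in> K \<Longrightarrow> f j \<in> I"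
  shows "finsum R f K \<in> I"
proof -
  interpret I: ideal I R by fact
  show ?thesis using assms(2,3)
    by (induction rule: finite_induct) (auto simp: Pi_def I.Icarr)
qed

lemma ideal_mem_of_finsum_mem:
  assumes "ideal I R" "finite K" "k \<in> K" "\<And>j. j \<in> K \<Longrightarrow> f j \<in> carrier R"
    and rest: "\<And>j. j \<in> K - {k} \<Longrightarrow> f j \<in> I" and sum: "finsum R f K \<in> I"
  shows "f k \<in> I"
proof -
  interpret I: ideal I R by fact
  let ?r = "finsum R f (K - {k})"
  have r: "?r \<in> I" using assms by (intro finsum_in_ideal) auto
  have K: "K = insert k (K - {k})" using assms by blast
  have "finsum R f K = f k \<oplus> ?r"
    by (subst K, rule finsum_insert) (use assms in auto)
  then have "f k = finsum R f K \<oplus> \<ominus> ?r"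
    using r assms by (simp add: I.Icarr a_assoc r_neg)
  with sum r show ?thesis by simp
qed

end

section \<open>Ideals of polynomials with coefficients in an ideal\<close>

context UP_cring
begin

lemma mem_poly_extension_iff:
  "p \<in> poly_extension R I \<longleftrightarrow> p \<in> carrier P \<and> (\<forall>n. coeff P p n \<in> I)"
  by (simp add: poly_extension_def P_def)

lemma ideal_poly_extension:
  assumes "ideal I R"
  shows "ideal (poly_extension R I) P"
proof (rule idealI)
  interpret I: ideal I R by fact
  show "ring P" by (rule P.ring_axioms)
  show "subgroup (poly_extension R I) (add_monoid P)"
  proof (rule P.add.subgroupI)
    have "\<zero>\<^bsub>P\<^esub> \<in> poly_extension R I" by (simp add: mem_poly_extension_iff)
    then show "poly_extension R I \<noteq> {}" by blast
  qed (auto simp: mem_poly_extension_iff)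
  show r: "q \<otimes>\<^bsub>P\<^esub> p \<in> poly_extension R I" if "p \<in> poly_extension R I" "q \<in> carrier P" for p q
    using that
    by (auto simp: mem_poly_extension_iff intro!: R.finsum_in_ideal[OF assms] I.I_l_closed)
  show "p \<otimes>\<^bsub>P\<^esub> q \<in> poly_extension R I" if "p \<in> poly_extension R I" "q \<in> carrier P" for p q
    using r[OF that] that by (simp add: mem_poly_extension_iff P.m_comm)
qed

text \<open>
  McCoy's theorem for \<open>(R/B)[x]\<close>, phrased without the quotient, by induction on the
  strict bound \<open>n\<close> for the degree of \<open>g\<close> modulo \<open>B\<close>. In the step to \<open>n + 1\<close>, let \<open>b\<^sub>n\<close> be the
  coefficient of \<open>g\<close> with index \<open>n\<close>, the last that may lie outside \<open>B\<close>, and go down through the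
  coefficients \<open>a\<^sub>i\<close> of \<open>f\<close>. Once \<open>a\<^sub>j g\<close> is in \<open>B[x]\<close> for all \<open>j > i\<close>, only the term
  \<open>a\<^sub>i b\<^sub>n\<close> of the coefficient of \<open>f g\<close> with index \<open>i + n\<close> can lie outside \<open>B\<close>. As \<open>f g\<close> is in
  \<open>B[x]\<close>, that term is in \<open>B\<close> too. Thus \<open>a\<^sub>i g\<close> satisfies the smaller bound, its product with
  \<open>f\<close> is still in \<open>B[x]\<close>, and by induction it is in \<open>B[x]\<close> itself. For \<open>i = k\<close> the factor can
  be cancelled.
\<close>
lemma cancel_modulo_poly_extension_bounded:
  assumes "ideal B R" "f \<in> carrier P"
    and cancel: "\<And>b. b \<in> carrier R \<Longrightarrow> coeff P f k \<otimes> b \<in> B \<Longrightarrow> b \<in> B"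
    and "g \<in> carrier P" "f \<otimes>\<^bsub>P\<^esub> g \<in> poly_extension R B" "\<And>m. m \<ge> n \<Longrightarrow> coeff P g m \<in> B"
  shows "g \<in> poly_extension R B"
  using assms(4-6)
proof (induction n arbitrary: g)
  case 0
  then show ?case by (simp add: mem_poly_extension_iff)
next
  case (Suc n g)
  interpret B: ideal B R by fact
  interpret BX: ideal "poly_extension R B" P by (rule ideal_poly_extension) fact
  note f = \<open>f \<in> carrier P\<close> and g = Suc.prems(1)
  have *: "coeff P f i \<odot>\<^bsub>P\<^esub> g \<in> poly_extension R B" for i
  proof (induction "Suc (deg R f) - i" arbitrary: i rule: less_induct)
    case less
    show ?case
    proof (cases "i \<le> deg R f")
      case False
      \<comment> \<open>Here the coefficient is zero; this starts the downward induction.\<close>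
      then show ?thesis
        using f g by (simp add: deg_aboveD mem_poly_extension_iff)
    next
      case True
      have "coeff P f i \<otimes> coeff P g (i + n - i) \<in> B"
      proof (rule R.ideal_mem_of_finsum_mem[where K = "{..i + n}" and k = i
            and f = "\<lambda>j. coeff P f j \<otimes> coeff P g (i + n - j)"])
        show "(\<Oplus>j\<in>{..i + n}. coeff P f j \<otimes> coeff P g (i + n - j)) \<in> B"
          using Suc.prems(2) f g by (auto simp: mem_poly_extension_iff)
      next
        fix j assume j: "j \<in> {..i + n} - {i}"
        show "coeff P f j \<otimes> coeff P g (i + n - j) \<in> B"
        proof (cases "j < i")
          case True
          then have "coeff P g (i + n - j) \<in> B" by (intro Suc.prems(3)) simp
          then show ?thesis using f by (simp add: B.I_l_closed)
        next
          case False
          then have "coeff P f j \<odot>\<^bsub>P\<^esub> g \<in> poly_extension R B"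
            using j True by (intro less) auto
          then show ?thesis using f g by (simp add: mem_poly_extension_iff)
        qed
      qed (use f g assms(1) in auto)
      then have top: "coeff P f i \<otimes> coeff P g n \<in> B" by simp
      show ?thesis
      proof (rule Suc.IH)
        show "coeff P f i \<odot>\<^bsub>P\<^esub> g \<in> carrier P" using f g by simp
        have "f \<otimes>\<^bsub>P\<^esub> (coeff P f i \<odot>\<^bsub>P\<^esub> g) = monom P (coeff P f i) 0 \<otimes>\<^bsub>P\<^esub> (f \<otimes>\<^bsub>P\<^esub> g)"
          using f g by (simp add: monom_mult_is_smult[symmetric] P.m_lcomm)
        then show "f \<otimes>\<^bsub>P\<^esub> (coeff P f i \<odot>\<^bsub>P\<^esub> g) \<in> poly_extension R B"
          using f Suc.prems(2) by (simp add: BX.I_l_closed)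
      next
        fix m assume "n \<le> m"
        then consider "m = n" | "Suc n \<le> m" by linarith
        then show "coeff P (coeff P f i \<odot>\<^bsub>P\<^esub> g) m \<in> B"
          using top f g by cases (auto simp: B.I_l_closed Suc.prems(3))
      qed
    qed
  qed
  have "coeff P f k \<otimes> coeff P g m \<in> B" for m
    using *[of k] f g by (simp add: mem_poly_extension_iff)
  then have "coeff P g m \<in> B" for m
    by (rule cancel[OF coeff_closed[OF g]])
  then show ?case
    using g by (simp add: mem_poly_extension_iff)
qed

lemma cancel_modulo_poly_extension:
  assumes "ideal B R" "f \<in> carrier P" "g \<in> carrier P"
    and "\<And>b. b \<in> carrier R \<Longrightarrow> coeff P f k \<otimes> b \<in> B \<Longrightarrow> b \<in> B"
    and "f \<otimes>\<^bsub>P\<^esub> g \<in> poly_extension R B"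
  shows "g \<in> poly_extension R B"
proof -
  interpret B: ideal B R by fact
  have "coeff P g m \<in> B" if "m \<ge> Suc (deg R g)" for m
    using that assms(3) by (simp add: deg_aboveD)
  with assms(1,2,4,3,5) show ?thesis
    by (rule cancel_modulo_poly_extension_bounded)
qed

section \<open>Regular polynomials and regular constants\<close>

text \<open>
  A constant that annihilates all coefficients of \<open>f\<close> annihilates \<open>f\<close>. Only the coefficients up to
  the degree are collected, so that the set is finite and, containing the coefficient of index 0,
  nonempty.
\<close>
lemma regular_poly_obtains_regular_coeff:
  assumes "finite_annihilator_condition R" "f \<in> carrier P" "annihilator P {f} = {\<zero>\<^bsub>P\<^esub>}"
  obtains k where "annihilator R {coeff P f k} = {\<zero>}"
proof -
  let ?F = "coeff P f ` {..deg R f}"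
  have "?F \<subseteq> carrier R \<and> finite ?F \<and> ?F \<noteq> {}" using assms(2) by auto
  with assms(1) have "\<exists>w\<in>?F. annihilator R ?F = annihilator R {w}"
    unfolding finite_annihilator_condition_def by (elim allE impE)
  then obtain w where w: "w \<in> ?F" "annihilator R ?F = annihilator R {w}"
    by (elim bexE)
  have "y = \<zero>" if y: "y \<in> annihilator R ?F" for y
  proof -
    have yc: "y \<in> carrier R" using y by (simp add: annihilator_def)
    have "y \<otimes> coeff P f n = \<zero>" for n
    proof (cases "n \<le> deg R f")
      case True
      with y show ?thesis by (simp add: annihilator_def)
    next
      case False
      with assms(2) yc show ?thesis by (simp add: deg_aboveD)
    qed
    then have "monom P y 0 \<otimes>\<^bsub>P\<^esub> f = \<zero>\<^bsub>P\<^esub>"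
      using assms(2) yc by (intro up_eqI) (simp_all add: monom_mult_is_smult)
    then have "monom P y 0 \<in> annihilator P {f}"
      using yc by (simp add: annihilator_def)
    then have "coeff P (monom P y 0) 0 = coeff P \<zero>\<^bsub>P\<^esub> 0" using assms(3) by simp
    then show "y = \<zero>" using yc by simp
  qed
  moreover have "\<zero> \<in> annihilator R ?F" using assms(2) by (auto simp: annihilator_def)
  ultimately have "annihilator R ?F = {\<zero>}" by blast
  with w(2) have "annihilator R {w} = {\<zero>}" by simp
  with w(1) that show thesis by auto
qed

lemma constant_poly_regular:
  assumes "w \<in> carrier R" "annihilator R {w} = {\<zero>}"
  shows "annihilator P {monom P w 0} = {\<zero>\<^bsub>P\<^esub>}"
proof -
  have "p = \<zero>\<^bsub>P\<^esub>" if p: "p \<in> carrier P" "p \<otimes>\<^bsub>P\<^esub> monom P w 0 = \<zero>\<^bsub>P\<^esub>" for p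
  proof (rule up_eqI)
    fix n
    have "w \<odot>\<^bsub>P\<^esub> p = \<zero>\<^bsub>P\<^esub>"
      using p assms(1) by (simp add: P.m_comm monom_mult_is_smult[symmetric])
    then have "coeff P (w \<odot>\<^bsub>P\<^esub> p) n = \<zero>" by simp
    then have "coeff P p n \<otimes> w = \<zero>" using p(1) assms(1) by (simp add: R.m_comm)
    then show "coeff P p n = coeff P \<zero>\<^bsub>P\<^esub> n"
      using p(1) assms by (simp add: R.annihilator_singleton_trivial_iff)
  qed (use p in auto)
  then show ?thesis
    using P.annihilator_singleton_trivial_iff[OF monom_closed[OF assms(1)]] by blast
qed

lemma monom_in_poly_extension_iff:
  assumes "ideal I R" "a \<in> carrier R"
  shows "monom P a 0 \<in> poly_extension R I \<longleftrightarrow> a \<in> I"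
proof -
  interpret I: ideal I R by fact
  show ?thesis using assms(2) by (auto simp: mem_poly_extension_iff)
qed

section \<open>Transfer of the \<open>S\<close>-\<open>r\<close>-property\<close>

lemma disjoint_constant_polys_iff:
  assumes "ideal I R" "S \<subseteq> carrier R"
  shows "poly_extension R I \<inter> constant_polys R S = {} \<longleftrightarrow> I \<inter> S = {}"
proof -
  have "monom P s 0 \<in> poly_extension R I \<longleftrightarrow> s \<in> I" if "s \<in> S" for s
    using assms that by (intro monom_in_poly_extension_iff) auto
  then show ?thesis
    unfolding constant_polys_def P_def[symmetric] by blast
qed

lemma S_r_ideal_poly_extension:
  assumes "finite_annihilator_condition R" "S \<subseteq> carrier R" "S_r_ideal R S A"
  shows "S_r_ideal P (constant_polys R S) (poly_extension R A)"
proof -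
  have A: "ideal A R" and disj: "A \<inter> S = {}" using assms(3) by (auto simp: S_r_ideal_def)
  obtain s where s: "s \<in> S" and r_prop: "\<And>w z. w \<in> carrier R \<Longrightarrow> z \<in> carrier R \<Longrightarrow>
      w \<otimes> z \<in> A \<Longrightarrow> annihilator R {w} = {\<zero>} \<Longrightarrow> s \<otimes> z \<in> A"
    using assms(3) unfolding S_r_ideal_def by blast
  have sc: "s \<in> carrier R" using s assms(2) by blast
  let ?B = "regular_saturation R A"
  have "monom P s 0 \<otimes>\<^bsub>P\<^esub> g \<in> poly_extension R A"
    if f: "f \<in> carrier P" and g: "g \<in> carrier P" and fg: "f \<otimes>\<^bsub>P\<^esub> g \<in> poly_extension R A"
      and reg: "annihilator P {f} = {\<zero>\<^bsub>P\<^esub>}" for f g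
  proof -
    obtain k where k: "annihilator R {coeff P f k} = {\<zero>}"
      using assms(1) f reg by (rule regular_poly_obtains_regular_coeff)
    have "g \<in> poly_extension R ?B"
    proof (rule cancel_modulo_poly_extension[OF R.ideal_regular_saturation[OF A] f g])
      show "b \<in> ?B" if "b \<in> carrier R" "coeff P f k \<otimes> b \<in> ?B" for b
        using that f k by (intro R.regular_saturation_cancel[of "coeff P f k" b A]) auto
      show "f \<otimes>\<^bsub>P\<^esub> g \<in> poly_extension R ?B"
        using fg R.subset_regular_saturation[OF A] by (auto simp: mem_poly_extension_iff)
    qed
    then have "coeff P g n \<in> ?B" for n by (simp add: mem_poly_extension_iff)
    then have "s \<otimes> coeff P g n \<in> A" for n
      by (meson r_prop R.regular_saturationE)
    then show ?thesis
      using sc g by (simp add: mem_poly_extension_iff monom_mult_is_smult)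
  qed
  moreover have "monom P s 0 \<in> constant_polys R S"
    using s by (simp add: constant_polys_def P_def)
  ultimately show ?thesis
    using ideal_poly_extension[OF A] disjoint_constant_polys_iff[OF A assms(2)] disj
    unfolding S_r_ideal_def by blast
qed

lemma S_r_ideal_of_poly_extension:
  assumes "ideal A R" "S \<subseteq> carrier R"
    and "S_r_ideal P (constant_polys R S) (poly_extension R A)"
  shows "S_r_ideal R S A"
proof -
  obtain s where s: "s \<in> S" and r_prop: "\<And>f g. f \<in> carrier P \<Longrightarrow> g \<in> carrier P \<Longrightarrow>
      f \<otimes>\<^bsub>P\<^esub> g \<in> poly_extension R A \<Longrightarrow> annihilator P {f} = {\<zero>\<^bsub>P\<^esub>} \<Longrightarrow>
      monom P s 0 \<otimes>\<^bsub>P\<^esub> g \<in> poly_extension R A"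
    using assms(3) unfolding S_r_ideal_def constant_polys_def P_def[symmetric] by blast
  have sc: "s \<in> carrier R" using s assms(2) by blast
  have "s \<otimes> z \<in> A"
    if "w \<in> carrier R" "z \<in> carrier R" "w \<otimes> z \<in> A" "annihilator R {w} = {\<zero>}" for w z
  proof -
    have mult: "monom P a 0 \<otimes>\<^bsub>P\<^esub> monom P z 0 = monom P (a \<otimes> z) 0" if "a \<in> carrier R" for a
      using that \<open>z \<in> carrier R\<close> monom_mult[of a z 0 0] by simp
    have "monom P s 0 \<otimes>\<^bsub>P\<^esub> monom P z 0 \<in> poly_extension R A"
      using that assms(1)
      by (intro r_prop[of "monom P w 0"])
        (simp_all add: mult monom_in_poly_extension_iff constant_poly_regular)
    then show ?thesis
      using that sc assms(1) by (simp add: mult monom_in_poly_extension_iff)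
  qed
  moreover have "A \<inter> S = {}"
    using assms disjoint_constant_polys_iff by (simp add: S_r_ideal_def)
  ultimately show ?thesis
    using assms(1) s unfolding S_r_ideal_def by blast
qed

end

theorem theorem4p2:
  fixes H :: "('a, 'm) ring_scheme" and S A :: "'a set"
  assumes "cring H"
    and "finite_annihilator_condition H"
    and "submonoid S H"
    and "ideal A H"
  shows "S_r_ideal H S A \<longleftrightarrow>
         S_r_ideal (UP H) (constant_polys H S) (poly_extension H A)"
proof -
  interpret UP_cring H "UP H"
    using assms(1) by (rule UP_cring.intro)
  have "S \<subseteq> carrier H" using assms(3) by (rule submonoid.subset)
  with assms show ?thesis
    using S_r_ideal_poly_extension S_r_ideal_of_poly_extension by blast
qed

end
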